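(* Let $\mathcal{P}$ be an $n$-dimensional convex polyhedron in $\mathbb{R}^m$ and let $p\in\mathbb{R}^m$. Then a point $e\in\mathcal{P}$ is the nearest point of $\mathcal{P}$ to $p$ if and only if $e$ has no escape toward $p$ along $\mathcal{P}$ or along any face of $\mathcal{P}$ containing $e$.
   Context: All distances and orthogonal projections are Euclidean. A polyhedron is the solution set of a finite system of (non-strict) linear inequalities and equalities; its dimension is the dimension of its affine hull. $\mathcal{A}(X)$ denotes the affine hull of a set $X$. Faces are nonempty. Escape: let $e\in F$ where $F$ is a face of $\mathcal{P}$ or $F=\mathcal{P}$ itself, and let $\pi_F$ be the orthogonal projection of $p$ onto $\mathcal{A}(F)$. An escape from $e$ toward $p$ along $F$ is a point $e'\neq e$ such that $e'=e+t_0(\pi_F-e)$, where $t_0\in(0,1]$ is largest such that $e+t_0(\pi_F-e)\in\mathcal{P}$. (Thus there is no escape along $F$ if $\pi_F=e$ or if $e+t(\pi_F-e)\notin\mathcal{P}$ for all $t\in(0,1]$.) *)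

theory Defs
  imports "HOL-Analysis.Analysis"
begin

definition orth_proj :: "'a::euclidean_space set \<Rightarrow> 'a \<Rightarrow> 'a" where
  "orth_proj A p = (THE q. q \<in> A \<and> (\<forall>x\<in>A. orthogonal (p - q) (x - q)))"

lemma orth_proj_ex1:
  fixes A :: "'a::euclidean_space set"
  assumes "affine A" "A \<noteq> {}"
  shows "\<exists>!q. q \<in> A \<and> (\<forall>x\<in>A. orthogonal (p - q) (x - q))"
proof (rule ex_ex1I)
  let ?q = "closest_point A p"
  have cl: "closed A" and cv: "convex A"
    using assms(1) by (simp_all add: affine_closed affine_imp_convex)
  have q: "?q \<in> A"
    using cl assms(2) by (rule closest_point_in_set)
  have "orthogonal (p - ?q) (x - ?q)" if x: "x \<in> A" for x
  proof -
    have "2 *\<^sub>R ?q + (-1) *\<^sub>R x \<in> A"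
      using assms(1) q x by (rule mem_affine) simp
    then have "inner (p - ?q) (2 *\<^sub>R ?q + (-1) *\<^sub>R x - ?q) \<le> 0"
      by (rule closest_point_dot[OF cv cl])
    then have "inner (p - ?q) (- (x - ?q)) \<le> 0"
      by (simp add: scaleR_2 algebra_simps)
    moreover have "inner (p - ?q) (x - ?q) \<le> 0"
      using closest_point_dot[OF cv cl x] .
    ultimately show ?thesis
      by (simp add: orthogonal_def del: minus_diff_eq)
  qed
  then show "\<exists>q. q \<in> A \<and> (\<forall>x\<in>A. orthogonal (p - q) (x - q))"
    using q by blast
next
  fix q r
  assume "q \<in> A \<and> (\<forall>x\<in>A. orthogonal (p - q) (x - q))"
    and "r \<in> A \<and> (\<forall>x\<in>A. orthogonal (p - r) (x - r))"
  then have "inner (p - q) (r - q) = 0" "inner (p - r) (q - r) = 0"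
    by (auto simp: orthogonal_def)
  then have "inner (q - r) (q - r) = 0"
    by (simp add: inner_diff_left inner_diff_right inner_commute)
  then show "q = r"
    by simp
qed

lemma orth_proj:
  assumes "affine A" "A \<noteq> {}"
  shows "orth_proj A p \<in> A" "x \<in> A \<Longrightarrow> orthogonal (p - orth_proj A p) (x - orth_proj A p)"
  using theI'[OF orth_proj_ex1[OF assms, of p]] unfolding orth_proj_def by blast+

text \<open>The point \<open>e'\<close> is an escape from \<open>e\<close> toward \<open>p\<close> along \<open>F\<close>. Intended for \<open>e \<in> F\<close>, where
  \<open>F\<close> is \<open>P\<close> or a face of \<open>P\<close>.\<close>

definition is_escape ::
    "'a::euclidean_space set \<Rightarrow> 'a \<Rightarrow> 'a set \<Rightarrow> 'a \<Rightarrow> 'a \<Rightarrow> bool" where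
  "is_escape P p F e e' \<longleftrightarrow>
    (let \<pi> = orth_proj (affine hull F) p in
      e' \<noteq> e \<and>
      (\<exists>t\<^sub>0\<in>{0<..1}.
        e' = e + t\<^sub>0 *\<^sub>R (\<pi> - e) \<and>
        e + t\<^sub>0 *\<^sub>R (\<pi> - e) \<in> P \<and>
        (\<forall>t\<in>{0<..1}. e + t *\<^sub>R (\<pi> - e) \<in> P \<longrightarrow> t \<le> t\<^sub>0)))"

end

(* An escape along F is strictly closer to p by Pythagoras.  Conversely, if e is not nearest, choose
   a minimal face F containing e and some x with (p - e) . (x - e) > 0, and let q be the projection
   of p onto the affine hull of F; then also (p - e) . (q - e) > 0.  If there is no escape along F,
   points slightly beyond e in the direction q - e lie outside F, whereas points slightly beyond e in
   the direction x - e lie in F.  Joining two such points near e, one crosses a facet of F which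
   contains e, at a point y with (p - e) . (y - e) > 0: this contradicts minimality. *)

theory Submission
  imports Defs
begin

lemma escape_closer:
  fixes P F :: "'a::euclidean_space set"
  assumes "e \<in> F" and esc: "is_escape P p F e e'"
  shows "e' \<in> P" "dist p e' < dist p e"
proof -
  define q where "q = orth_proj (affine hull F) p"
  obtain t where t: "0 < t" "t \<le> 1" and e': "e' = e + t *\<^sub>R (q - e)" "e' \<noteq> e" "e' \<in> P"
    using esc unfolding is_escape_def Let_def q_def by auto
  show "e' \<in> P" by fact
  have "e \<in> affine hull F"
    using assms(1) by (rule hull_inc)
  then have "orthogonal (p - q) (e - q)"
    unfolding q_def by (intro orth_proj(2)) auto
  then have "(p - q) \<bullet> (q - e) = 0"
    by (simp add: orthogonal_def inner_diff_right)
  then have orth: "orthogonal (p - q) (r *\<^sub>R (q - e))" for r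
    by (simp add: orthogonal_def)
  \<comment> \<open>Pythagoras with \<open>p - q\<close> orthogonal to the direction of motion. Only
    the factor \<open>(1 - r)\<^sup>2\<close> varies, and it is below its value at
    \<open>r = 0\<close> for every \<open>r\<close> in (0,1].\<close>
  have "(norm (p - (e + r *\<^sub>R (q - e))))\<^sup>2 = (norm (p - q))\<^sup>2 + (1 - r)\<^sup>2 * (norm (q - e))\<^sup>2" for r
  proof -
    have "p - (e + r *\<^sub>R (q - e)) = (p - q) + (1 - r) *\<^sub>R (q - e)"
      by (simp add: algebra_simps)
    then show ?thesis
      using norm_add_Pythagorean[OF orth, of "1 - r"] by (simp only: norm_scaleR power_mult_distrib power2_abs)
  qed
  from this[of t] this[of 0]
  have "(norm (p - e'))\<^sup>2 = (norm (p - q))\<^sup>2 + (1 - t)\<^sup>2 * (norm (q - e))\<^sup>2"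
    and "(norm (p - e))\<^sup>2 = (norm (p - q))\<^sup>2 + (norm (q - e))\<^sup>2"
    by (simp_all add: e')
  moreover have "(1 - t)\<^sup>2 * (norm (q - e))\<^sup>2 < 1 * (norm (q - e))\<^sup>2"
    using t e'(1,2) by (intro mult_strict_right_mono) (auto simp: abs_square_less_1)
  ultimately have "(norm (p - e'))\<^sup>2 < (norm (p - e))\<^sup>2"
    by linarith
  then show "dist p e' < dist p e"
    unfolding dist_norm by (rule power2_less_imp_less) simp
qed

text \<open>A positive parameter that stays in \<open>P\<close> would yield a largest one by
  compactness, and that one defines an escape.\<close>

lemma no_escape_notin:
  fixes P F :: "'a::euclidean_space set"
  assumes "closed P" and "\<nexists>e'. is_escape P p F e e'"
    and "orth_proj (affine hull F) p \<noteq> e"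
    and "0 < t" "t \<le> 1"
  shows "e + t *\<^sub>R (orth_proj (affine hull F) p - e) \<notin> P"
proof
  define v where "v = orth_proj (affine hull F) p - e"
  let ?T = "{0..1} \<inter> (\<lambda>s. e + s *\<^sub>R v) -` P"
  assume "e + t *\<^sub>R (orth_proj (affine hull F) p - e) \<in> P"
  then have t: "t \<in> ?T"
    using assms(4,5) by (simp add: v_def)
  have "closed ((\<lambda>s. e + s *\<^sub>R v) -` P)"
    by (intro closed_vimage[OF assms(1)] continuous_intros)
  then have "compact ?T"
    by (rule compact_Int_closed[OF compact_Icc])
  then obtain t0 where t0: "t0 \<in> ?T" "\<forall>s\<in>?T. s \<le> t0"
    using compact_attains_sup[of ?T] t by blast
  then have "0 < t0"
    using t assms(4) by (meson less_le_trans)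
  have "is_escape P p F e (e + t0 *\<^sub>R v)"
    unfolding is_escape_def Let_def v_def[symmetric]
    using t0 \<open>0 < t0\<close> assms(3) by (auto simp: v_def)
  with assms(2) show False by blast
qed

text \<open>If \<open>T\<close> missed the relative frontier, \<open>rel_interior S\<close> and
  \<open>closure S\<close> would both cut out \<open>T \<inter> S\<close> from \<open>T\<close>,
  making it clopen in \<open>T\<close>. Openness relies on \<open>T\<close> lying in the affine hull
  of \<open>S\<close>.\<close>

lemma connected_Int_rel_frontier:
  fixes S T :: "'a::euclidean_space set"
  assumes T: "connected T" "T \<subseteq> affine hull S" "T \<inter> S \<noteq> {}" "T - S \<noteq> {}"
  shows "T \<inter> rel_frontier S \<noteq> {}"
proof
  assume "T \<inter> rel_frontier S = {}"
  then have eq: "T \<inter> S = T \<inter> rel_interior S" "T \<inter> S = T \<inter> closure S"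
    using rel_interior_subset[of S] closure_subset[of S] by (auto simp: rel_frontier_def)
  have "openin (top_of_set T) (T \<inter> S)"
    unfolding eq(1) using openin_rel_interior[of S] T(2) by (auto simp: openin_subtopology)
  moreover have "closedin (top_of_set T) (T \<inter> S)"
    unfolding eq(2) by (simp add: closedin_closed_Int)
  ultimately show False
    using T unfolding connected_clopen by blast
qed

text \<open>The faces that avoid \<open>e\<close> are closed and finite in number, so their union
  has positive distance from \<open>e\<close> unless it is empty.\<close>

lemma ball_misses_faces:
  fixes P :: "'a::euclidean_space set"
  assumes "polyhedron P"
  obtains d where "d > 0" "\<And>F x. F face_of P \<Longrightarrow> x \<in> F \<Longrightarrow> x \<in> ball e d \<Longrightarrow> e \<in> F"
proof -
  let ?A = "{F. F face_of P \<and> e \<notin> F}"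
  have "finite ?A"
    by (rule finite_subset[OF _ finite_polyhedron_faces[OF assms]]) blast
  moreover have "\<forall>F\<in>?A. closed F"
    using assms by (auto intro: face_of_imp_closed polyhedron_imp_closed polyhedron_imp_convex)
  ultimately have "open (- \<Union>?A)"
    by (simp add: closed_Union open_Compl)
  then obtain d where "d > 0" "ball e d \<subseteq> - \<Union>?A"
    by (rule openE) auto
  then show thesis
    by (intro that[of d]) blast+
qed

text \<open>Converse of \<open>closest_point_dot\<close>, by expanding the squared norm of
  \<open>(p - e) - (z - e)\<close>.\<close>

lemma closest_point_if_dot_le:
  fixes P :: "'a::euclidean_space set"
  assumes "closed P" "convex P" "e \<in> P" "\<And>x. x \<in> P \<Longrightarrow> (p - e) \<bullet> (x - e) \<le> 0"
  shows "e = closest_point P p"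
proof (rule closest_point_unique)
  show "\<forall>z\<in>P. dist p e \<le> dist p z"
  proof
    fix z assume "z \<in> P"
    have "(norm (p - z))\<^sup>2 = (norm (p - e))\<^sup>2 + (norm (z - e))\<^sup>2 - 2 * ((p - e) \<bullet> (z - e))"
      unfolding power2_norm_eq_inner by (simp add: algebra_simps inner_commute)
    then have "(norm (p - e))\<^sup>2 \<le> (norm (p - z))\<^sup>2"
      using assms(4)[OF \<open>z \<in> P\<close>] by (smt (verit) zero_le_power2)
    then show "dist p e \<le> dist p z"
      unfolding dist_norm by (rule power2_le_imp_le) simp
  qed
qed (use assms in auto)

lemma no_escape_imp_closest:
  fixes P :: "'a::euclidean_space set"
  assumes P: "polyhedron P" and e: "e \<in> P"
    and no: "\<And>F. F face_of P \<Longrightarrow> e \<in> F \<Longrightarrow> \<nexists>e'. is_escape P p F e e'"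
  shows "e = closest_point P p"
proof (rule closest_point_if_dot_le)
  show cl: "closed P" and cv: "convex P"
    using P by (auto intro: polyhedron_imp_closed polyhedron_imp_convex)
  \<comment> \<open>The faces through \<open>e\<close> that contain a direction from
    \<open>e\<close> at an acute angle to \<open>p - e\<close>.\<close>
  let ?A = "{F. F face_of P \<and> e \<in> F \<and> (\<exists>x\<in>F. 0 < (p - e) \<bullet> (x - e))}"
  have "?A = {}"
  proof (rule ccontr)
    assume "?A \<noteq> {}"
    moreover have "finite ?A"
      by (rule finite_subset[OF _ finite_polyhedron_faces[OF P]]) blast
    ultimately obtain F where F: "F \<in> ?A" "\<forall>G\<in>?A. G \<subseteq> F \<longrightarrow> F = G"
      using finite_has_minimal[of ?A] by meson
    from F(1) obtain x where fa: "F face_of P" and eF: "e \<in> F" and x: "x \<in> F" "0 < (p - e) \<bullet> (x - e)"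
      by blast
    have pF: "polyhedron F"
      using face_of_polyhedron_polyhedron[OF P fa] .
    then have cvF: "convex F"
      by (rule polyhedron_imp_convex)
    define q where "q = orth_proj (affine hull F) p"
    have ha: "e \<in> affine hull F" "x \<in> affine hull F"
      using eF x by (auto intro: hull_inc)
    then have q: "q \<in> affine hull F"
      unfolding q_def by (intro orth_proj(1)) auto
    have orth: "(p - q) \<bullet> (z - q) = 0" if "z \<in> affine hull F" for z
      using orth_proj(2)[of "affine hull F" z p] that eF unfolding q_def orthogonal_def by auto
    \<comment> \<open>Otherwise \<open>p - e\<close> would be orthogonal to
      \<open>x - e\<close>.\<close>
    have "q \<noteq> e"
      using orth[OF ha(2)] x(2) by auto
    have "(p - e) \<bullet> (q - e) = (q - e) \<bullet> (q - e)"
      using orth[OF ha(1)] by (simp add: inner_diff_left inner_diff_right)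
    with \<open>q \<noteq> e\<close> have qpos: "0 < (p - e) \<bullet> (q - e)"
      by simp
    obtain d where d: "d > 0" "\<And>G y. G face_of P \<Longrightarrow> y \<in> G \<Longrightarrow> y \<in> ball e d \<Longrightarrow> e \<in> G"
      using ball_misses_faces[OF P] by blast
    \<comment> \<open>The \<open>+ 1\<close> keeps the quotient positive for \<open>w = 0\<close>
      and makes the bound by \<open>d\<close> strict.\<close>
    have near: "\<exists>s. 0 < s \<and> s \<le> 1 \<and> e + s *\<^sub>R w \<in> ball e d" for w
    proof (intro exI conjI)
      let ?s = "min 1 (d / (norm w + 1))"
      have pos: "norm w + 1 > 0" by (simp add: add_nonneg_pos)
      show "0 < ?s" "?s \<le> 1" using d pos by auto
      have "?s * norm w \<le> d / (norm w + 1) * norm w"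
        by (intro mult_right_mono) auto
      also have "\<dots> < d"
        using d pos by (simp add: field_simps)
      finally show "e + ?s *\<^sub>R w \<in> ball e d"
        using \<open>0 < ?s\<close> by (simp add: dist_norm)
    qed
    obtain s where s: "0 < s" "s \<le> 1" "e + s *\<^sub>R (x - e) \<in> ball e d"
      using near by blast
    obtain t where t: "0 < t" "t \<le> 1" "e + t *\<^sub>R (q - e) \<in> ball e d"
      using near by blast
    define a where "a = e + s *\<^sub>R (x - e)"
    define b where "b = e + t *\<^sub>R (q - e)"
    have "b \<notin> P"
      using no_escape_notin[OF cl no[OF fa eF] _ t(1,2)] \<open>q \<noteq> e\<close> by (simp add: b_def q_def)
    have "a = (1 - s) *\<^sub>R e + s *\<^sub>R x" "b = (1 - t) *\<^sub>R e + t *\<^sub>R q"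
      by (simp_all add: a_def b_def algebra_simps)
    then have aF: "a \<in> F" and bA: "b \<in> affine hull F"
      using s eF x(1) cvF ha q by (simp_all add: convexD_alt mem_affine)
    \<comment> \<open>Convexity keeps the segment from \<open>a\<close> to \<open>b\<close> inside.
      The affine hull permits the frontier argument, the ball forces \<open>e\<close> into the facet
      that is met, and the half-space puts that facet into \<open>?A\<close>.\<close>
    let ?C = "affine hull F \<inter> ball e d \<inter> {y. (p - e) \<bullet> y > (p - e) \<bullet> e}"
    have C: "convex ?C"
      by (intro convex_Int convex_ball convex_halfspace_gt affine_imp_convex affine_affine_hull)
    have "a \<in> ?C" "b \<in> ?C"
      using s t x(2) qpos aF bA by (simp_all add: a_def b_def inner_add_right hull_inc)
    moreover have "b \<notin> F"
      using \<open>b \<notin> P\<close> face_of_imp_subset[OF fa] by blast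
    ultimately have "?C \<inter> rel_frontier F \<noteq> {}"
      using aF by (intro connected_Int_rel_frontier convex_connected[OF C]) blast+
    then obtain y G where y: "y \<in> ?C" "y \<in> G" and G: "G facet_of F"
      unfolding rel_frontier_of_polyhedron[OF pF] by blast
    have "G face_of P"
      using face_of_trans[OF facet_of_imp_face_of[OF G] fa] .
    moreover have "e \<in> G"
      using d(2)[OF \<open>G face_of P\<close> y(2)] y(1) by blast
    moreover have "0 < (p - e) \<bullet> (y - e)"
      using y(1) by (simp add: inner_diff_right)
    \<comment> \<open>Minimality of \<open>F\<close> in \<open>?A\<close>; but a facet of
      \<open>F\<close> is never \<open>F\<close> itself.\<close>
    ultimately have "G = F"
      using F(2) y(2) facet_of_imp_subset[OF G] by blast
    with G show False by simp
  qed
  \<comment> \<open>\<open>P\<close> is a face of itself, so a point of \<open>P\<close> with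
    positive product would put \<open>P\<close> into \<open>?A\<close>.\<close>
  then show "(p - e) \<bullet> (x - e) \<le> 0" if "x \<in> P" for x
    using that e face_of_refl[OF cv] by (metis (mono_tags, lifting) empty_Collect_eq not_less)
qed (fact e)

theorem theorem1p2:
  fixes P :: "(real ^ 'm) set" and p e :: "real ^ 'm" and n :: nat
  assumes "polyhedron P"
    and "aff_dim P = int n"
    and "e \<in> P"
  shows "e = closest_point P p \<longleftrightarrow>
    (\<nexists>e'. is_escape P p P e e') \<and>
    (\<forall>F. F face_of P \<and> F \<noteq> {} \<and> e \<in> F \<longrightarrow> (\<nexists>e'. is_escape P p F e e'))"
proof
  assume close: "e = closest_point P p"
  \<comment> \<open>Stated for any set \<open>F\<close> through \<open>e\<close>, so that it covers
    \<open>P\<close> and its faces at once.\<close>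
  have "\<not> is_escape P p F e e'" if "e \<in> F" for F e'
    using escape_closer[OF that] closest_point_le[OF polyhedron_imp_closed[OF assms(1)], of e' p]
    unfolding close[symmetric] by fastforce
  with assms(3) show "(\<nexists>e'. is_escape P p P e e') \<and>
    (\<forall>F. F face_of P \<and> F \<noteq> {} \<and> e \<in> F \<longrightarrow> (\<nexists>e'. is_escape P p F e e'))"
    by blast
next
  assume "(\<nexists>e'. is_escape P p P e e') \<and>
    (\<forall>F. F face_of P \<and> F \<noteq> {} \<and> e \<in> F \<longrightarrow> (\<nexists>e'. is_escape P p F e e'))"
  then show "e = closest_point P p"
    by (intro no_escape_imp_closest assms) blast
qed

end
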